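(* Let $R$ be an associative (not necessarily commutative) ring with unity and $M$ a non-zero left $R$-module. Then $(\mathrm{Spec}^{\mathrm{f}}(M),\tau_c^{\mathrm{f}}(M))$ is a topological space, i.e. $\tau_c^{\mathrm{f}}(M)=\{\mathrm{Spec}^{\mathrm{f}}(M)\setminus V((0:_M I))\mid I\text{ a two-sided ideal of }R\}$ is the family of open sets of a topology on $\mathrm{Spec}^{\mathrm{f}}(M)$.
   Context: A left $R$-module $P$ is prime if $P\neq 0$ and $\mathrm{ann}_R(N)=\mathrm{ann}_R(P)$ for every non-zero submodule $N\le P$. A first submodule of $M$ is a submodule of $M$ that is prime as an $R$-module; $\mathrm{Spec}^{\mathrm{f}}(M)$ is the set of first submodules of $M$. For a submodule $N\le M$, $V(N)=\{P\in\mathrm{Spec}^{\mathrm{f}}(M)\mid P\subseteq N\}$. For a two-sided ideal $I$ of $R$, $(0:_M I)=\{m\in M\mid Im=0\}$, a submodule of $M$. *)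

theory Defs
  imports "HOL-Algebra.Module" "HOL-Algebra.Ideal" "HOL-Analysis.Abstract_Topology"
begin

text \<open>
  The library locale \<open>Module.module\<close> assumes a commutative ring of scalars. The following locale has the
  same axioms over an arbitrary ring; \<open>left_module_iff_module\<close> below relates the two.
\<close>

locale left_module = R?: ring R + M?: abelian_group M for R (structure) and M (structure) +
  assumes smult_closed [simp, intro]:
      "\<lbrakk>a \<in> carrier R; x \<in> carrier M\<rbrakk> \<Longrightarrow> a \<odot>\<^bsub>M\<^esub> x \<in> carrier M"
    and smult_l_distr:
      "\<lbrakk>a \<in> carrier R; b \<in> carrier R; x \<in> carrier M\<rbrakk> \<Longrightarrow>
        (a \<oplus> b) \<odot>\<^bsub>M\<^esub> x = a \<odot>\<^bsub>M\<^esub> x \<oplus>\<^bsub>M\<^esub> b \<odot>\<^bsub>M\<^esub> x"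
    and smult_r_distr:
      "\<lbrakk>a \<in> carrier R; x \<in> carrier M; y \<in> carrier M\<rbrakk> \<Longrightarrow>
        a \<odot>\<^bsub>M\<^esub> (x \<oplus>\<^bsub>M\<^esub> y) = a \<odot>\<^bsub>M\<^esub> x \<oplus>\<^bsub>M\<^esub> a \<odot>\<^bsub>M\<^esub> y"
    and smult_assoc1:
      "\<lbrakk>a \<in> carrier R; b \<in> carrier R; x \<in> carrier M\<rbrakk> \<Longrightarrow>
        (a \<otimes> b) \<odot>\<^bsub>M\<^esub> x = a \<odot>\<^bsub>M\<^esub> (b \<odot>\<^bsub>M\<^esub> x)"
    and smult_one [simp]:
      "x \<in> carrier M \<Longrightarrow> \<one> \<odot>\<^bsub>M\<^esub> x = x"

lemma left_module_iff_module:
  assumes "cring R"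
  shows "left_module R M \<longleftrightarrow> Module.module R M"
  using assms
  by (auto simp: left_module_def left_module_axioms_def Module.module_def Module.module_axioms_def cring.axioms(1))

definition annihilator ::
    "('a, 'r) ring_scheme \<Rightarrow> ('a, 'b, 'm) module_scheme \<Rightarrow> 'b set \<Rightarrow> 'a set"
  where "annihilator R M N = {r \<in> carrier R. \<forall>x\<in>N. r \<odot>\<^bsub>M\<^esub> x = \<zero>\<^bsub>M\<^esub>}"

definition prime_left_module ::
    "('a, 'r) ring_scheme \<Rightarrow> ('a, 'b, 'm) module_scheme \<Rightarrow> bool"
  where "prime_left_module R P \<longleftrightarrow>
    left_module R P \<and> carrier P \<noteq> {\<zero>\<^bsub>P\<^esub>} \<and>
    (\<forall>N. submodule N R P \<and> N \<noteq> {\<zero>\<^bsub>P\<^esub>} \<longrightarrow>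
      annihilator R P N = annihilator R P (carrier P))"

definition first_submodule ::
    "('a, 'r) ring_scheme \<Rightarrow> ('a, 'b, 'm) module_scheme \<Rightarrow> 'b set \<Rightarrow> bool"
  where "first_submodule R M P \<longleftrightarrow> submodule P R M \<and> prime_left_module R (M\<lparr>carrier := P\<rparr>)"

definition first_spectrum ::
    "('a, 'r) ring_scheme \<Rightarrow> ('a, 'b, 'm) module_scheme \<Rightarrow> 'b set set"
  where "first_spectrum R M = {P. first_submodule R M P}"

text \<open>\<open>first_below R M N\<close> is $V(N)$; \<open>zero_residual M I\<close> is $(0 :_M I)$.\<close>

definition first_below ::
    "('a, 'r) ring_scheme \<Rightarrow> ('a, 'b, 'm) module_scheme \<Rightarrow> 'b set \<Rightarrow> 'b set set"
  where "first_below R M N = {P \<in> first_spectrum R M. P \<subseteq> N}"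

definition zero_residual :: "('a, 'b, 'm) module_scheme \<Rightarrow> 'a set \<Rightarrow> 'b set"
  where "zero_residual M I = {m \<in> carrier M. \<forall>r\<in>I. r \<odot>\<^bsub>M\<^esub> m = \<zero>\<^bsub>M\<^esub>}"

definition first_opens ::
    "('a, 'r) ring_scheme \<Rightarrow> ('a, 'b, 'm) module_scheme \<Rightarrow> 'b set set set"
  where "first_opens R M =
    {first_spectrum R M - first_below R M (zero_residual M I) | I. ideal I R}"

end

(* A first submodule P lies in (0 :_M I) iff I annihilates P. Hence the claim reduces to facts about the
   two-sided ideal ann P. Unions of opens correspond to the ideal generated by a union of ideals, the whole
   spectrum to I = R. Finite intersections use primeness: if I \<inter> J annihilates P, then so does J I, so
   I P is contained in the submodule of elements of P killed by J; either that submodule vanishes, whence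
   I P = 0, or it has the same annihilator as P, whence J P = 0. *)
theory Submission
  imports Defs
begin

context left_module
begin

lemma smult_l_null [simp]:
  assumes "x \<in> carrier M"
  shows "\<zero> \<odot>\<^bsub>M\<^esub> x = \<zero>\<^bsub>M\<^esub>"
proof -
  have "\<zero> \<odot>\<^bsub>M\<^esub> x \<oplus>\<^bsub>M\<^esub> \<zero> \<odot>\<^bsub>M\<^esub> x = \<zero> \<odot>\<^bsub>M\<^esub> x"
    using assms smult_l_distr[of \<zero> \<zero> x] by simp
  then show ?thesis
    using assms by (metis M.add.r_cancel_one' R.zero_closed smult_closed)
qed

lemma smult_r_null [simp]:
  assumes "a \<in> carrier R"
  shows "a \<odot>\<^bsub>M\<^esub> \<zero>\<^bsub>M\<^esub> = \<zero>\<^bsub>M\<^esub>"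
proof -
  have "a \<odot>\<^bsub>M\<^esub> \<zero>\<^bsub>M\<^esub> \<oplus>\<^bsub>M\<^esub> a \<odot>\<^bsub>M\<^esub> \<zero>\<^bsub>M\<^esub> = a \<odot>\<^bsub>M\<^esub> \<zero>\<^bsub>M\<^esub>"
    using assms smult_r_distr[of a "\<zero>\<^bsub>M\<^esub>" "\<zero>\<^bsub>M\<^esub>"] by simp
  then show ?thesis
    using assms by (metis M.add.r_cancel_one' M.zero_closed smult_closed)
qed

lemma smult_l_minus:
  assumes "a \<in> carrier R" "x \<in> carrier M"
  shows "(\<ominus> a) \<odot>\<^bsub>M\<^esub> x = \<ominus>\<^bsub>M\<^esub> (a \<odot>\<^bsub>M\<^esub> x)"
proof -
  have "(\<ominus> a) \<odot>\<^bsub>M\<^esub> x \<oplus>\<^bsub>M\<^esub> a \<odot>\<^bsub>M\<^esub> x = \<zero>\<^bsub>M\<^esub>"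
    using assms smult_l_distr[of "\<ominus> a" a x] by (simp add: R.l_neg)
  then show ?thesis
    using assms by (simp add: M.minus_equality)
qed

lemma smult_r_minus:
  assumes "a \<in> carrier R" "x \<in> carrier M"
  shows "a \<odot>\<^bsub>M\<^esub> (\<ominus>\<^bsub>M\<^esub> x) = \<ominus>\<^bsub>M\<^esub> (a \<odot>\<^bsub>M\<^esub> x)"
proof -
  have "a \<odot>\<^bsub>M\<^esub> (\<ominus>\<^bsub>M\<^esub> x) \<oplus>\<^bsub>M\<^esub> a \<odot>\<^bsub>M\<^esub> x = \<zero>\<^bsub>M\<^esub>"
    using assms smult_r_distr[of a "\<ominus>\<^bsub>M\<^esub> x" x] by (simp add: M.l_neg)
  then show ?thesis
    using assms by (simp add: M.minus_equality)
qed

text \<open>Absorption on the right is where the whole carrier matters: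
  \<open>(a r) x = a (r x)\<close>, and \<open>r x\<close> is again an element that \<open>a\<close>
  kills. An arbitrary subset of the carrier would in general give only a left ideal.\<close>

lemma ideal_annihilator_carrier: "ideal (annihilator R M (carrier M)) R"
proof (rule idealI)
  show "subgroup (annihilator R M (carrier M)) (add_monoid R)"
  proof (rule R.add.subgroupI)
    show "annihilator R M (carrier M) \<noteq> {}"
      unfolding annihilator_def using smult_l_null by blast
  qed (auto simp: annihilator_def smult_l_minus smult_l_distr)
qed (auto simp: annihilator_def smult_assoc1 R.ring_axioms)

text \<open>Stability under scalars rests on right absorption: for \<open>r\<close> in
  \<open>I\<close>, \<open>r (a x) = (r a) x\<close> with \<open>r a\<close> in \<open>I\<close>.
  Primeness can thus be tested on this set.\<close>

lemma submodule_zero_residual: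
  assumes "ideal I R"
  shows "submodule (zero_residual M I) R M"
proof -
  interpret I: ideal I R by fact
  have "subgroup (zero_residual M I) (add_monoid M)"
  proof (rule M.add.subgroupI)
    show "zero_residual M I \<noteq> {}"
      unfolding zero_residual_def using I.Icarr smult_r_null by blast
  qed (auto simp: zero_residual_def smult_r_minus smult_r_distr I.Icarr)
  moreover have "r \<odot>\<^bsub>M\<^esub> (a \<odot>\<^bsub>M\<^esub> x) = \<zero>\<^bsub>M\<^esub>"
    if "a \<in> carrier R" "x \<in> zero_residual M I" "r \<in> I" for a x r
    using that I.I_r_closed[of r a] smult_assoc1[of r a x] I.Icarr[of r]
    by (auto simp: zero_residual_def)
  ultimately show ?thesis
    by (auto simp: submodule_def submodule_axioms_def zero_residual_def)
qed

end

lemma prime_left_module_inter_annihilator: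
  assumes "prime_left_module R P" and "ideal I R" and "ideal J R"
    and sub: "I \<inter> J \<subseteq> annihilator R P (carrier P)"
  shows "I \<subseteq> annihilator R P (carrier P) \<or> J \<subseteq> annihilator R P (carrier P)"
proof -
  interpret P: left_module R P using assms(1) by (simp add: prime_left_module_def)
  interpret I: ideal I R by fact
  interpret J: ideal J R by fact
  let ?N = "zero_residual P J"
  have IP: "i \<odot>\<^bsub>P\<^esub> p \<in> ?N" if "i \<in> I" "p \<in> carrier P" for i p
  proof -
    have "j \<odot>\<^bsub>P\<^esub> (i \<odot>\<^bsub>P\<^esub> p) = \<zero>\<^bsub>P\<^esub>" if "j \<in> J" for j
    proof -
      \<comment> \<open>The order is forced, since \<open>i\<close> acts first on \<open>p\<close>.
        The product lies in \<open>I\<close> by left absorption and in \<open>J\<close> by right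
        absorption.\<close>
      have "j \<otimes>\<^bsub>R\<^esub> i \<in> I \<inter> J"
        using \<open>i \<in> I\<close> \<open>j \<in> J\<close> by (simp add: I.I_l_closed J.I_r_closed I.Icarr J.Icarr)
      then show ?thesis
        using sub \<open>p \<in> carrier P\<close> P.smult_assoc1[of j i p] I.Icarr[OF \<open>i \<in> I\<close>] J.Icarr[OF \<open>j \<in> J\<close>]
        by (auto simp: annihilator_def)
    qed
    then show ?thesis using that I.Icarr by (simp add: zero_residual_def)
  qed
  show ?thesis
  proof (cases "?N = {\<zero>\<^bsub>P\<^esub>}")
    case True
    then show ?thesis using IP I.Icarr by (auto simp: annihilator_def)
  next
    case False
    then have "annihilator R P ?N = annihilator R P (carrier P)"
      using assms(1) P.submodule_zero_residual[OF assms(3)] by (simp add: prime_left_module_def)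
    moreover have "J \<subseteq> annihilator R P ?N"
      using J.Icarr by (auto simp: annihilator_def zero_residual_def)
    ultimately show ?thesis by simp
  qed
qed

text \<open>Only the scalar action and the zero of the module enter, and changing the carrier alters
  neither. Facts about \<open>P\<close> as a module thereby transfer to annihilators taken in
  \<open>M\<close>.\<close>

lemma annihilator_carrier_update [simp]:
  "annihilator R (M\<lparr>carrier := P\<rparr>) N = annihilator R M N"
  by (simp add: annihilator_def)

text \<open>Regarded as a module of its own, \<open>P\<close> is the whole carrier, which makes its
  annihilator two-sided.\<close>

lemma first_submodule_ideal_annihilator:
  assumes "P \<in> first_spectrum R M"
  shows "ideal (annihilator R M P) R"
proof -
  interpret left_module R "M\<lparr>carrier := P\<rparr>"
    using assms by (simp add: first_spectrum_def first_submodule_def prime_left_module_def)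
  show ?thesis using ideal_annihilator_carrier by simp
qed

lemma first_submodule_inter_annihilator:
  assumes "P \<in> first_spectrum R M" and "ideal I R" and "ideal J R"
  shows "I \<inter> J \<subseteq> annihilator R M P \<longleftrightarrow> I \<subseteq> annihilator R M P \<or> J \<subseteq> annihilator R M P"
  using prime_left_module_inter_annihilator[of R "M\<lparr>carrier := P\<rparr>" I J] assms
  by (auto simp: first_spectrum_def first_submodule_def)

text \<open>Otherwise \<open>1\<close> would act on \<open>P\<close> both as the identity and as
  zero, forcing \<open>P\<close> to be zero.\<close>

lemma first_submodule_annihilator_neq_carrier:
  assumes "P \<in> first_spectrum R M"
  shows "\<not> carrier R \<subseteq> annihilator R M P"
proof
  assume R: "carrier R \<subseteq> annihilator R M P"
  interpret left_module R "M\<lparr>carrier := P\<rparr>"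
    using assms by (simp add: first_spectrum_def first_submodule_def prime_left_module_def)
  have "x = \<zero>\<^bsub>M\<^esub>" if "x \<in> P" for x
    using that smult_one[of x] R R.one_closed by (auto simp: annihilator_def)
  \<comment> \<open>In the interpreted module the carrier is \<open>P\<close> and the zero is that
    of \<open>M\<close>; this excludes an empty \<open>P\<close>.\<close>
  moreover have "\<zero>\<^bsub>M\<^esub> \<in> P"
    using M.zero_closed by simp
  ultimately have "P = {\<zero>\<^bsub>M\<^esub>}"
    by blast
  then show False
    using assms by (simp add: first_spectrum_def first_submodule_def prime_left_module_def)
qed

text \<open>Containment in the residual and containment in the annihilator both say that every
  \<open>r\<close> in \<open>I\<close> kills every \<open>x\<close> in \<open>P\<close>. From here
  on opens are handled through ideals of \<open>R\<close> alone.\<close>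

lemma first_spectrum_diff_first_below:
  assumes "ideal I R"
  shows "first_spectrum R M - first_below R M (zero_residual M I)
       = {P \<in> first_spectrum R M. \<not> I \<subseteq> annihilator R M P}"
proof -
  have "P \<subseteq> zero_residual M I \<longleftrightarrow> I \<subseteq> annihilator R M P" if "P \<in> first_spectrum R M" for P
  proof -
    have "P \<subseteq> carrier M"
      using that subgroup.subset[of P "add_monoid M"]
      by (simp add: first_spectrum_def first_submodule_def submodule_def)
    then show ?thesis
      using ideal.Icarr[OF assms] by (auto simp: zero_residual_def annihilator_def)
  qed
  then show ?thesis by (auto simp: first_below_def)
qed

lemma first_opens_iff:
  "U \<in> first_opens R M \<longleftrightarrow>
    (\<exists>I. ideal I R \<and> U = {P \<in> first_spectrum R M. \<not> I \<subseteq> annihilator R M P})"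
  unfolding first_opens_def using first_spectrum_diff_first_below[of _ R M] by auto

lemma first_opens_Int:
  assumes "ring R" and "U \<in> first_opens R M" and "V \<in> first_opens R M"
  shows "U \<inter> V \<in> first_opens R M"
proof -
  obtain I J where "ideal I R" "ideal J R"
    and "U = {P \<in> first_spectrum R M. \<not> I \<subseteq> annihilator R M P}"
    and "V = {P \<in> first_spectrum R M. \<not> J \<subseteq> annihilator R M P}"
    using assms(2,3) by (auto simp: first_opens_iff)
  \<comment> \<open>The negated form of the prime property of the annihilator: it misses part of
    \<open>I \<inter> J\<close> exactly when it misses part of \<open>I\<close> and part of
    \<open>J\<close>.\<close>
  then have "U \<inter> V = {P \<in> first_spectrum R M. \<not> I \<inter> J \<subseteq> annihilator R M P}"
    using first_submodule_inter_annihilator[of _ R M I J] by blast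
  then show ?thesis
    using ring.i_intersect[OF assms(1)] \<open>ideal I R\<close> \<open>ideal J R\<close> first_opens_iff by blast
qed

lemma first_opens_Union:
  assumes "ring R" and "\<U> \<subseteq> first_opens R M"
  shows "\<Union>\<U> \<in> first_opens R M"
proof -
  \<comment> \<open>Different ideals may define the same open set, so \<open>I\<close> is a choice
    function on the family.\<close>
  obtain I where I: "ideal (I U) R" "U = {P \<in> first_spectrum R M. \<not> I U \<subseteq> annihilator R M P}"
    if "U \<in> \<U>" for U
    using assms(2) first_opens_iff[of _ R M] by (metis subsetD)
  let ?S = "\<Union>U\<in>\<U>. I U"
  have "?S \<subseteq> carrier R"
    using I(1) ideal.Icarr by fastforce
  then have ideal: "ideal (Idl\<^bsub>R\<^esub> ?S) R"
    using ring.genideal_ideal[OF assms(1)] by blast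
  \<comment> \<open>The annihilator is a two-sided ideal, so it contains the generated ideal as soon
    as it contains the generators. For the empty family this is the zero ideal, which yields the
    empty open set.\<close>
  have "Idl\<^bsub>R\<^esub> ?S \<subseteq> annihilator R M P \<longleftrightarrow> (\<forall>U\<in>\<U>. I U \<subseteq> annihilator R M P)"
    if "P \<in> first_spectrum R M" for P
    using ring.Idl_subset_ideal[OF assms(1) first_submodule_ideal_annihilator[OF that] \<open>?S \<subseteq> carrier R\<close>]
    by blast
  then have "\<Union>\<U> = {P \<in> first_spectrum R M. \<not> Idl\<^bsub>R\<^esub> ?S \<subseteq> annihilator R M P}"
    using I(2) by blast
  then show ?thesis
    using ideal first_opens_iff by blast
qed

lemma first_spectrum_in_first_opens:
  assumes "ring R"
  shows "first_spectrum R M \<in> first_opens R M"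
proof -
  have "first_spectrum R M = {P \<in> first_spectrum R M. \<not> carrier R \<subseteq> annihilator R M P}"
    using first_submodule_annihilator_neq_carrier by blast
  then show ?thesis
    using ring.oneideal[OF assms] first_opens_iff by blast
qed

theorem theorem4p7:
  fixes R :: "('a, 'r) ring_scheme" and M :: "('a, 'b, 'm) module_scheme"
  assumes "left_module R M"
    and "carrier M \<noteq> {\<zero>\<^bsub>M\<^esub>}"
  shows "istopology (\<lambda>U. U \<in> first_opens R M) \<and>
    topspace (topology (\<lambda>U. U \<in> first_opens R M)) = first_spectrum R M"
proof
  have R: "ring R" using assms(1) by (simp add: left_module_def)
  \<comment> \<open>\<open>istopology\<close> asks for binary intersections and arbitrary unions,
    the empty set being the empty union. That the whole spectrum is open enters with
    \<open>topspace\<close>, the union of all opens.\<close>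
  show top: "istopology (\<lambda>U. U \<in> first_opens R M)"
    unfolding istopology_def using first_opens_Int[OF R] first_opens_Union[OF R] by blast
  have "topspace (topology (\<lambda>U. U \<in> first_opens R M)) = \<Union>(first_opens R M)"
    by (simp add: topspace_def topology_inverse'[OF top])
  also have "\<dots> = first_spectrum R M"
  proof
    show "\<Union>(first_opens R M) \<subseteq> first_spectrum R M"
      by (auto simp: first_opens_def)
    show "first_spectrum R M \<subseteq> \<Union>(first_opens R M)"
      by (rule Union_upper) (rule first_spectrum_in_first_opens[OF R])
  qed
  finally show "topspace (topology (\<lambda>U. U \<in> first_opens R M)) = first_spectrum R M" .
qed

end
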